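(* Let $$\mathcal P=\{C_{a,b}: a,b\in\mathbb Z,\ b>0,\ \gcd(a,b)=1\},$$ $$\mathcal B=\{\langle s,t\rangle: s,t,u\in\mathbb Z,\ \gcd(s,t,u)=1,\ s+t>0,\ (s+t+u)^2=s^2+t^2+u^2\},$$ and let $\mathcal G$ be the set of circles obtained from $\mathcal G_0=\{C_{n,1}:n\in\mathbb Z\}$ by repeatedly adjoining children (as defined in the context). Then $\mathcal B=\mathcal P=\mathcal G$.
   Context: For $t\in\mathbb R$, $r>0$, $C(t,r)$ is the circle in the $x,y$-plane with center $(t,r)$ and radius $r$ (so it lies above the $x$-axis and is tangent to it at $t$); such circles are called normal. For real $a,b$ with $b>0$, $C_{a,b}:=C\left(\frac ab,\frac1{2b^2}\right)$. For real $a,b$ with $a+b>0$, $\langle a,b\rangle:=C\left(\frac b{a+b},\frac1{2(a+b)}\right)$. Given two tangent normal circles, tangent to the $x$-axis at $x$ and $y$, there is a unique normal circle tangent to both of them and tangent to the $x$-axis at a point strictly between $x$ and $y$; it is called the child of the two circles. A set of circles is normal if all its circles are normal and no two of them have intersecting interiors. For normal sets of circles $\mathcal A,\mathcal A'$ write $\mathcal A\lessdot\mathcal A'$ if $\mathcal A'=\mathcal A\cup\{C\}$ where $C$ is the child of two tangent circles in $\mathcal A$. The set $\mathcal G$ is the union of all normal sets $\mathcal G'$ for which there is a finite chain $\mathcal G_0\lessdot\cdots\lessdot\mathcal G'$. *)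

theory Defs
  imports "HOL-Analysis.Analysis"
begin

text \<open>Circles are point sets in the Euclidean plane \<^typ>\<open>real \<times> real\<close>; the metric on the product
  type is the Euclidean one, so \<^const>\<open>sphere\<close> and \<^const>\<open>ball\<close> are round circles and discs.\<close>

definition circ :: "real \<Rightarrow> real \<Rightarrow> (real \<times> real) set" where
  "circ t r = sphere (t, r) r"

definition ford_circ :: "real \<Rightarrow> real \<Rightarrow> (real \<times> real) set" where
  "ford_circ a b = circ (a / b) (1 / (2 * b\<^sup>2))"

definition angle_circ :: "real \<Rightarrow> real \<Rightarrow> (real \<times> real) set" where
  "angle_circ a b = circ (b / (a + b)) (1 / (2 * (a + b)))"

definition normal_circle :: "(real \<times> real) set \<Rightarrow> bool" where
  "normal_circle C \<longleftrightarrow> (\<exists>t r. r > 0 \<and> C = circ t r)"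

text \<open>Two circles of positive radius are tangent iff they meet in exactly one point.
  This includes internal tangency; see the remark on children below.\<close>

definition tangent :: "(real \<times> real) set \<Rightarrow> (real \<times> real) set \<Rightarrow> bool" where
  "tangent C D \<longleftrightarrow> (\<exists>p. C \<inter> D = {p})"

text \<open>The circle \<^term>\<open>circ t r\<close> touches the horizontal axis at \<^term>\<open>t\<close>.  Internally tangent
  normal circles touch the axis at the same point, so they have no child: nothing lies
  strictly between \<^term>\<open>t\<close> and \<^term>\<open>t\<close>.  Otherwise the child is unique.\<close>

definition is_child ::
  "(real \<times> real) set \<Rightarrow> (real \<times> real) set \<Rightarrow> (real \<times> real) set \<Rightarrow> bool" where
  "is_child C D E \<longleftrightarrow> (\<exists>x r y s t q. r > 0 \<and> s > 0 \<and> q > 0 \<and>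
     D = circ x r \<and> E = circ y s \<and> C = circ t q \<and>
     min x y < t \<and> t < max x y \<and>
     tangent D E \<and> tangent C D \<and> tangent C E)"

text \<open>The interior of a circle is the open disc it bounds.\<close>

definition normal_set :: "(real \<times> real) set set \<Rightarrow> bool" where
  "normal_set \<A> \<longleftrightarrow> (\<forall>C\<in>\<A>. normal_circle C) \<and>
     (\<forall>t r t' r'. r > 0 \<longrightarrow> r' > 0 \<longrightarrow> circ t r \<in> \<A> \<longrightarrow> circ t' r' \<in> \<A> \<longrightarrow>
        circ t r \<noteq> circ t' r' \<longrightarrow> ball (t, r) r \<inter> ball (t', r') r' = {})"

definition adjoins_child :: "(real \<times> real) set set \<Rightarrow> (real \<times> real) set set \<Rightarrow> bool"
    (infix "\<lessdot>" 50) where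
  "\<A> \<lessdot> \<A>' \<longleftrightarrow> normal_set \<A> \<and> normal_set \<A>' \<and>
     (\<exists>C D E. D \<in> \<A> \<and> E \<in> \<A> \<and> tangent D E \<and> is_child C D E \<and> \<A>' = \<A> \<union> {C})"

definition generated :: "(real \<times> real) set set \<Rightarrow> (real \<times> real) set set" where
  "generated \<G>\<^sub>0 = \<Union> {\<G>'. normal_set \<G>' \<and> (\<lessdot>)\<^sup>*\<^sup>* \<G>\<^sub>0 \<G>'}"

definition \<P> :: "(real \<times> real) set set" where
  "\<P> = {ford_circ (of_int a) (of_int b) | a b :: int. b > 0 \<and> gcd a b = 1}"

definition \<B> :: "(real \<times> real) set set" where
  "\<B> = {angle_circ (of_int s) (of_int t) | s t :: int.
         \<exists>u :: int. gcd s (gcd t u) = 1 \<and> s + t > 0 \<and> (s + t + u)\<^sup>2 = s\<^sup>2 + t\<^sup>2 + u\<^sup>2}"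

definition \<G> :: "(real \<times> real) set set" where
  "\<G> = generated {ford_circ (of_int n) 1 | n :: int. True}"

end

theory Submission
  imports Defs
begin

text \<open>The circle $C_{a,b}$ is the Ford circle at the fraction $a/b$.

  For $\<B> = \<P>$, the equation $(s+t+u)^2 = s^2+t^2+u^2$ says $st+tu+us=0$, that is,
  $(s+t)(t+u) = t^2$. A common divisor of $s+t$ and $t+u$ divides $t$, hence
  $s$ and $u$; so primitivity makes the two factors coprime, and both are squares,
  $s+t=b^2$, $t+u=a^2$, $t=ab$. Conversely each reduced fraction gives such a triple, and
  $t/(s+t) = a/b$, so the circles agree (\<open>angle_triple_iff_ford\<close>).

  For $\<P> = \<G>$, the geometry is translated into arithmetic by one formula: normal circles
  touching the axis at different points are tangent iff $(x-y)^2 = 4rs$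
  (\<open>tangent_circ_iff\<close>), which for $C_{a,b}$ and $C_{c,d}$ says $ad-bc=\<plusminus>1$. The child
  of two such circles is then the circle of the mediant $(a+c)/(b+d)$
  (\<open>child_ford_eq_mediant\<close>), so no child of circles in $\<P>$ leaves $\<P>$. In the other
  direction, every reduced fraction with $b>1$ is the mediant of two fractions with
  determinant $1$ and smaller denominators, so induction on the denominator produces every
  circle of $\<P>$ after finitely many steps (\<open>ford_circ_reachable\<close>). All sets met on the way
  are normal, because $\<P>$ is: $ad-bc$ is a nonzero integer for different reduced fractions,
  whence $(x-y)^2 \<ge> 4rs$, which keeps the discs apart.\<close>

section \<open>Normal circles in coordinates\<close>

lemma mem_circ_iff:
  assumes "r > 0"
  shows "(u, v) \<in> circ t r \<longleftrightarrow> (u - t)\<^sup>2 + (v - r)\<^sup>2 = r\<^sup>2"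
proof -
  have "(u, v) \<in> circ t r \<longleftrightarrow> sqrt ((u - t)\<^sup>2 + (v - r)\<^sup>2) = r"
    by (simp add: circ_def dist_Pair_Pair dist_real_def power2_commute)
  also have "\<dots> \<longleftrightarrow> (u - t)\<^sup>2 + (v - r)\<^sup>2 = r\<^sup>2"
    using assms by (metis abs_of_pos real_sqrt_abs real_sqrt_eq_iff)
  finally show ?thesis .
qed

text \<open>The lowest and the highest point of one circle lie on the other; the lowest
  forces the points of contact with the axis to agree.\<close>

lemma circ_eq_iff:
  assumes "r > 0" "r' > 0"
  shows "circ t r = circ t' r' \<longleftrightarrow> t = t' \<and> r = r'"
proof
  assume eq: "circ t r = circ t' r'"
  have "(t, 0) \<in> circ t' r'" "(t, 2 * r) \<in> circ t' r'"
    unfolding eq[symmetric] using assms by (simp_all add: mem_circ_iff)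
  then have "(t - t')\<^sup>2 + (0 - r')\<^sup>2 = r'\<^sup>2" "(t - t')\<^sup>2 + (2 * r - r')\<^sup>2 = r'\<^sup>2"
    using assms by (simp_all only: mem_circ_iff)
  then have "t = t'" "4 * r * (r - r') = 0"
    by (simp, simp add: power2_eq_square algebra_simps)
  then show "t = t' \<and> r = r'" using assms by simp
qed simp

text \<open>If the circles meet in a single point, then reflection in the line of centres fixes it,
  so it lies on that line. Hence the distance of the centres is $r+s$ or $|r-s|$, and the latter
  would put the centres on a vertical line.\<close>

lemma tangent_circ_imp:
  assumes "r > 0" "s > 0" "x \<noteq> y" and tan: "tangent (circ x r) (circ y s)"
  shows "(x - y)\<^sup>2 = 4 * r * s"
proof -
  obtain u v where uv: "circ x r \<inter> circ y s = {(u, v)}"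
    using tan unfolding tangent_def by auto
  define a b X Y where "a = u - x" and "b = v - r" and "X = y - x" and "Y = s - r"
  define d k where "d = X\<^sup>2 + Y\<^sup>2" and "k = 2 * (a * X + b * Y) / d"
  have "X \<noteq> 0" using assms by (simp add: X_def)
  then have "d > 0" by (simp add: d_def sum_power2_gt_zero_iff)
  then have k: "k * (X\<^sup>2 + Y\<^sup>2) = 2 * (a * X + b * Y)" by (simp add: k_def flip: d_def)
  have "(u, v) \<in> circ x r" "(u, v) \<in> circ y s" using uv by auto
  then have 1: "a\<^sup>2 + b\<^sup>2 = r\<^sup>2" and 2: "(a - X)\<^sup>2 + (b - Y)\<^sup>2 = s\<^sup>2"
    using assms by (simp_all add: mem_circ_iff a_def b_def X_def Y_def)
  \<comment> \<open>The vector from the first centre to the reflected point is $k(X,Y)-(a,b)$.\<close>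
  have "(k * X - a)\<^sup>2 + (k * Y - b)\<^sup>2 =
      k * (k * (X\<^sup>2 + Y\<^sup>2) - 2 * (a * X + b * Y)) + (a\<^sup>2 + b\<^sup>2)"
    by algebra
  then have 3: "(k * X - a)\<^sup>2 + (k * Y - b)\<^sup>2 = r\<^sup>2" by (simp add: k 1)
  have "(k * X - a - X)\<^sup>2 + (k * Y - b - Y)\<^sup>2 =
      (k - 2) * (k * (X\<^sup>2 + Y\<^sup>2) - 2 * (a * X + b * Y)) + ((a - X)\<^sup>2 + (b - Y)\<^sup>2)"
    by algebra
  then have 4: "(k * X - a - X)\<^sup>2 + (k * Y - b - Y)\<^sup>2 = s\<^sup>2" by (simp add: k 2)
  have "(x + (k * X - a), r + (k * Y - b)) \<in> circ x r \<inter> circ y s"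
    using 3 4 assms by (simp add: mem_circ_iff X_def Y_def algebra_simps)
  then have ab: "2 * a = k * X" "2 * b = k * Y" by (simp_all add: uv a_def b_def)
  define l where "l = k / 2"
  have al: "a = l * X" and bl: "b = l * Y" using ab by (simp_all add: l_def)
  have r2: "r\<^sup>2 = l\<^sup>2 * d"
    unfolding 1[symmetric] al bl d_def by algebra
  have s2: "s\<^sup>2 = (l - 1)\<^sup>2 * d"
    unfolding 2[symmetric] al bl d_def by algebra
  have "((r + s)\<^sup>2 - d) * ((r - s)\<^sup>2 - d) = (r\<^sup>2 - s\<^sup>2)\<^sup>2 - 2 * d * (r\<^sup>2 + s\<^sup>2) + d\<^sup>2"
    by algebra
  also have "\<dots> = 0" unfolding r2 s2 by algebra
  finally have "((r + s)\<^sup>2 - d) * ((r - s)\<^sup>2 - d) = 0" .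
  moreover have "(r - s)\<^sup>2 - d \<noteq> 0"
    using \<open>X \<noteq> 0\<close> by (simp add: d_def Y_def power2_commute)
  ultimately have "(r + s)\<^sup>2 = (y - x)\<^sup>2 + (s - r)\<^sup>2" by (simp add: d_def X_def Y_def)
  then show ?thesis by (simp add: power2_eq_square algebra_simps)
qed

text \<open>For external tangency the vectors from a common point to the centres have inner product
  $-rs$, so they are opposite, and the common point divides the segment of centres in the
  ratio $r:s$.\<close>

lemma tangent_circ_if:
  assumes "r > 0" "s > 0" and dist: "(x - y)\<^sup>2 = 4 * r * s"
  shows "tangent (circ x r) (circ y s)"
proof -
  define u v where "u = (s * x + r * y) / (r + s)" and "v = (s * r + r * s) / (r + s)"
  have pos: "r + s > 0" using assms by simp
  have sol: "u' = u \<and> v' = v"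
    if "(u' - x)\<^sup>2 + (v' - r)\<^sup>2 = r\<^sup>2" "(u' - y)\<^sup>2 + (v' - s)\<^sup>2 = s\<^sup>2" for u' v'
  proof -
    define A B where "A = (u' - x)\<^sup>2 + (v' - r)\<^sup>2" and "B = (u' - y)\<^sup>2 + (v' - s)\<^sup>2"
    \<comment> \<open>The coefficient of $rs$ is twice the inner product, by the cosine rule.\<close>
    have "(s * (u' - x) + r * (u' - y))\<^sup>2 + (s * (v' - r) + r * (v' - s))\<^sup>2 =
        s\<^sup>2 * A + r\<^sup>2 * B + r * s * (A + B - ((x - y)\<^sup>2 + (r - s)\<^sup>2))"
      unfolding A_def B_def by algebra
    also have "\<dots> = 0"
      unfolding A_def B_def that dist by algebra
    finally have "(s * (u' - x) + r * (u' - y))\<^sup>2 + (s * (v' - r) + r * (v' - s))\<^sup>2 = 0" .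
    then have "s * (u' - x) + r * (u' - y) = 0" "s * (v' - r) + r * (v' - s) = 0"
      by (simp_all add: sum_power2_eq_zero_iff)
    then show ?thesis using pos by (simp add: u_def v_def field_simps)
  qed
  have uv: "u - x = r * (y - x) / (r + s)" "v - r = r * (s - r) / (r + s)"
    "u - y = s * (x - y) / (r + s)" "v - s = s * (r - s) / (r + s)"
    using pos by (simp_all add: u_def v_def field_simps)
  have dists: "(x - y)\<^sup>2 + (r - s)\<^sup>2 = (r + s)\<^sup>2" "(y - x)\<^sup>2 + (s - r)\<^sup>2 = (r + s)\<^sup>2"
    using dist by (simp_all add: power2_eq_square algebra_simps)
  have "(u - x)\<^sup>2 + (v - r)\<^sup>2 = r\<^sup>2 * ((y - x)\<^sup>2 + (s - r)\<^sup>2) / (r + s)\<^sup>2"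
    "(u - y)\<^sup>2 + (v - s)\<^sup>2 = s\<^sup>2 * ((x - y)\<^sup>2 + (r - s)\<^sup>2) / (r + s)\<^sup>2"
    unfolding uv by (simp_all only: power_divide power_mult_distrib distrib_left add_divide_distrib)
  then have "(u - x)\<^sup>2 + (v - r)\<^sup>2 = r\<^sup>2" "(u - y)\<^sup>2 + (v - s)\<^sup>2 = s\<^sup>2"
    using pos by (simp_all add: dists)
  then have "(u, v) \<in> circ x r \<inter> circ y s" using assms(1,2) by (simp add: mem_circ_iff)
  moreover have "p = (u, v)" if "p \<in> circ x r \<inter> circ y s" for p
    using that sol[of "fst p" "snd p"] assms(1,2) mem_circ_iff[of _ "fst p" "snd p"]
    by (simp add: prod_eq_iff)
  ultimately have "circ x r \<inter> circ y s = {(u, v)}" by blast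
  then show ?thesis unfolding tangent_def by blast
qed

lemma tangent_circ_iff:
  assumes "r > 0" "s > 0" "x \<noteq> y"
  shows "tangent (circ x r) (circ y s) \<longleftrightarrow> (x - y)\<^sup>2 = 4 * r * s"
  using tangent_circ_imp tangent_circ_if assms by blast

text \<open>The hypothesis says that the distance of the centres is at least $r+s$.\<close>

lemma disjoint_balls_if:
  assumes "r > 0" "s > 0" and dist: "(x - y)\<^sup>2 \<ge> 4 * r * s"
  shows "ball (x, r) r \<inter> ball (y, s) s = {}"
proof -
  have "(r + s)\<^sup>2 \<le> (x - y)\<^sup>2 + (r - s)\<^sup>2"
    using dist by (simp add: power2_eq_square algebra_simps)
  then have "r + s \<le> dist (x, r) (y, s)"
    using real_le_rsqrt by (simp add: dist_Pair_Pair dist_real_def)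
  then show ?thesis by (rule disjoint_ballI)
qed

lemma is_child_commute:
  assumes "is_child C D E"
  shows "is_child C E D"
proof -
  obtain x r y s t q where *: "r > 0" "s > 0" "q > 0" "D = circ x r" "E = circ y s" "C = circ t q"
    "min x y < t" "t < max x y" "tangent D E" "tangent C D" "tangent C E"
    using assms unfolding is_child_def by (elim exE conjE) (rule that)
  have "min y x < t" "t < max y x" using *(7,8) by (simp_all only: min.commute max.commute)
  moreover have "tangent E D" using *(9) by (simp only: tangent_def Int_commute)
  ultimately show ?thesis
    unfolding is_child_def using * by (intro exI conjI)
qed

section \<open>Ford circles and mediants\<close>

lemma ford_radius_pos: "b > 0 \<Longrightarrow> 1 / (2 * b\<^sup>2) > (0::real)"
  by simp

lemma ford_square_distance:
  fixes a b c d :: real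
  assumes "b > 0" "d > 0"
  shows "(a / b - c / d)\<^sup>2 = (a * d - b * c)\<^sup>2 * (4 * (1 / (2 * b\<^sup>2)) * (1 / (2 * d\<^sup>2)))"
proof -
  have "a / b - c / d = (a * d - b * c) / (b * d)"
    using assms by (simp add: diff_frac_eq mult.commute)
  moreover have "4 * (1 / (2 * b\<^sup>2)) * (1 / (2 * d\<^sup>2)) = 1 / (b * d)\<^sup>2"
    by (simp add: power_mult_distrib)
  ultimately show ?thesis by (simp add: power_divide)
qed

lemma tangent_ford_iff:
  fixes a b c d :: real
  assumes "b > 0" "d > 0" "a / b \<noteq> c / d"
  shows "tangent (ford_circ a b) (ford_circ c d) \<longleftrightarrow> (a * d - b * c)\<^sup>2 = 1"
  unfolding ford_circ_def tangent_circ_iff[OF ford_radius_pos ford_radius_pos, OF assms]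
    ford_square_distance[OF assms(1,2)]
  using assms by simp

lemma tangent_ford_if_det:
  fixes a b c d :: real
  assumes "b > 0" "d > 0" "b * c - a * d = 1"
  shows "tangent (ford_circ a b) (ford_circ c d)"
proof -
  have "a / b \<noteq> c / d" using assms by (auto simp: field_simps)
  moreover have "(a * d - b * c)\<^sup>2 = 1" using assms(3) by algebra
  ultimately show ?thesis using assms by (simp add: tangent_ford_iff)
qed

lemma mediant_is_child:
  fixes a b c d :: real
  assumes "b > 0" "d > 0" and det: "b * c - a * d = 1"
  shows "is_child (ford_circ (a + c) (b + d)) (ford_circ a b) (ford_circ c d)"
proof -
  have less: "a / b < (a + c) / (b + d)" "(a + c) / (b + d) < c / d"
    using assms by (simp_all add: field_simps)
  have "tangent (ford_circ a b) (ford_circ (a + c) (b + d))"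
    "tangent (ford_circ (a + c) (b + d)) (ford_circ c d)"
    using assms by (auto intro!: tangent_ford_if_det simp: algebra_simps)
  then have "tangent (ford_circ (a + c) (b + d)) (ford_circ a b)"
    "tangent (ford_circ (a + c) (b + d)) (ford_circ c d)"
    by (simp_all add: tangent_def Int_commute)
  moreover have "tangent (ford_circ a b) (ford_circ c d)"
    using assms by (rule tangent_ford_if_det)
  moreover have "1 / (2 * b\<^sup>2) > 0" "1 / (2 * d\<^sup>2) > 0" "1 / (2 * (b + d)\<^sup>2) > 0"
    using assms by simp_all
  ultimately show ?thesis
    unfolding is_child_def ford_circ_def
    by (intro exI[of _ "a / b"] exI[of _ "1 / (2 * b\<^sup>2)"] exI[of _ "c / d"]
        exI[of _ "1 / (2 * d\<^sup>2)"] exI[of _ "(a + c) / (b + d)"] exI[of _ "1 / (2 * (b + d)\<^sup>2)"]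
        conjI refl min_less_iff_disj[THEN iffD2, OF disjI1, OF less(1)]
        less_max_iff_disj[THEN iffD2, OF disjI2, OF less(2)])
qed

text \<open>Write the radius of the child as $1/(2e^2)$. Tangency makes the distances between the three
  points of contact $1/(bd)$, $1/(be)$ and $1/(de)$; the first is the sum of the other two because
  the child lies in between, and this forces $e=b+d$.\<close>

lemma child_ford_eq_mediant:
  fixes a b c d :: real
  assumes "b > 0" "d > 0" and det: "b * c - a * d = 1"
    and child: "is_child C (ford_circ a b) (ford_circ c d)"
  shows "C = ford_circ (a + c) (b + d)"
proof -
  obtain x r y s t q where *: "r > 0" "s > 0" "q > 0"
    "ford_circ a b = circ x r" "ford_circ c d = circ y s" "C = circ t q"
    "min x y < t" "t < max x y" "tangent C (ford_circ a b)" "tangent C (ford_circ c d)"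
    using child unfolding is_child_def by (elim exE conjE) (rule that)
  have xy: "x = a / b" "r = 1 / (2 * b\<^sup>2)" "y = c / d" "s = 1 / (2 * d\<^sup>2)"
    using * assms(1,2) by (auto simp: ford_circ_def circ_eq_iff)
  have yx: "y - x = 1 / (b * d)"
    using assms by (simp add: xy field_simps)
  moreover have "1 / (b * d) > 0" using assms by simp
  ultimately have "x < y" by linarith
  then have t: "x < t" "t < y" using *(7,8) by auto
  define e where "e = 1 / sqrt (2 * q)"
  have e: "e > 0" "q = 1 / (2 * e\<^sup>2)"
    using \<open>q > 0\<close> by (simp_all add: e_def power_divide)
  have "(t - x)\<^sup>2 = 4 * q * r" "(t - y)\<^sup>2 = 4 * q * s"
    using *(9,10) t tangent_circ_imp[OF *(3,1), of t x] tangent_circ_imp[OF *(3,2), of t y]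
    unfolding *(4-6) by auto
  then have "(t - x)\<^sup>2 = (1 / (b * e))\<^sup>2" "(y - t)\<^sup>2 = (1 / (d * e))\<^sup>2"
    using assms e(1) by (simp_all add: xy e(2) field_simps power2_eq_square)
  then have tx: "t - x = 1 / (b * e)" and yt: "y - t = 1 / (d * e)"
    using t assms e(1) by (simp_all add: power2_eq_iff_nonneg)
  have "1 / (b * d) = 1 / (b * e) + 1 / (d * e)"
    using yx tx yt by linarith
  then have eb: "e = b + d"
    using assms e(1) by (simp add: field_simps)
  have "t = a / b + 1 / (b * (b + d))" using tx by (simp add: xy eb)
  also have "\<dots> = (a * (b + d) + (b * c - a * d)) / (b * (b + d))"
    using assms by (simp add: add_frac_eq divide_simps)
  also have "\<dots> = (b * (a + c)) / (b * (b + d))" by (simp add: algebra_simps)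
  also have "\<dots> = (a + c) / (b + d)" using assms by simp
  finally show ?thesis using * by (simp add: ford_circ_def e(2) eb)
qed

section \<open>The Ford circles form a normal set closed under children\<close>

lemma coprime_if_det:
  fixes a b c d :: int
  assumes "b * c - a * d = 1"
  shows "coprime a b"
proof (rule coprimeI)
  fix k assume "k dvd a" "k dvd b"
  then have "k dvd b * c - a * d" by simp
  then show "is_unit k" by (simp add: assms)
qed

lemma ford_circ_mem_\<P>: "b > 0 \<Longrightarrow> coprime a b \<Longrightarrow> ford_circ (of_int a) (of_int b) \<in> \<P>"
  unfolding \<P>_def coprime_iff_gcd_eq_1 by (intro CollectI exI[of _ a] exI[of _ b] conjI refl)

lemma mem_\<P>E:
  assumes "C \<in> \<P>"
  obtains a b :: int where "b > 0" "coprime a b" "C = ford_circ (of_int a) (of_int b)"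
proof -
  from assms obtain a b :: int
    where "b > 0" "gcd a b = 1" "C = ford_circ (of_int a) (of_int b)"
    unfolding \<P>_def by (elim CollectE exE conjE) (rule that)
  then show ?thesis by (intro that) (simp_all only: coprime_iff_gcd_eq_1)
qed

lemma coprime_fraction_unique:
  fixes a b c d :: int
  assumes "b > 0" "d > 0" "coprime a b" "coprime c d" "a * d = b * c"
  shows "a = c \<and> b = d"
proof -
  have "b dvd d" "d dvd b"
    using assms by (metis coprime_commute coprime_dvd_mult_right_iff dvd_triv_left,
        metis coprime_commute coprime_dvd_mult_left_iff dvd_triv_right)
  then have "b = d" using assms by (simp add: zdvd_antisym_nonneg)
  then show ?thesis using assms by simp
qed

lemma normal_set_subset: "normal_set \<A>' \<Longrightarrow> \<A> \<subseteq> \<A>' \<Longrightarrow> normal_set \<A>"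
  unfolding normal_set_def by blast

text \<open>For different reduced fractions $a/b$ and $c/d$ the integer $ad-bc$ is nonzero, so its square is at
  least $1$.\<close>

lemma normal_set_\<P>: "normal_set \<P>"
  unfolding normal_set_def
proof (intro conjI ballI allI impI)
  fix C assume "C \<in> \<P>"
  then obtain a b :: int where "b > 0" "C = ford_circ (of_int a) (of_int b)"
    by (rule mem_\<P>E)
  then show "normal_circle C"
    unfolding normal_circle_def ford_circ_def
    by (intro exI conjI[OF ford_radius_pos]) auto
next
  fix t r t' r' :: real
  assume pos: "r > 0" "r' > 0" and C: "circ t r \<in> \<P>" "circ t' r' \<in> \<P>"
    and neq: "circ t r \<noteq> circ t' r'"
  obtain a b :: int where ab: "b > 0" "coprime a b" "circ t r = ford_circ (of_int a) (of_int b)"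
    using C(1) by (rule mem_\<P>E)
  obtain c d :: int where cd: "d > 0" "coprime c d" "circ t' r' = ford_circ (of_int c) (of_int d)"
    using C(2) by (rule mem_\<P>E)
  have tr: "t = of_int a / of_int b" "r = 1 / (2 * (of_int b)\<^sup>2)"
    "t' = of_int c / of_int d" "r' = 1 / (2 * (of_int d)\<^sup>2)"
    using ab cd pos by (auto simp: ford_circ_def circ_eq_iff)
  have "a * d - b * c \<noteq> 0"
    using coprime_fraction_unique[of b d a c] ab cd neq by auto
  then have "(a * d - b * c)\<^sup>2 > 0" by simp
  then have "(a * d - b * c)\<^sup>2 \<ge> 1" by linarith
  then have "real_of_int ((a * d - b * c)\<^sup>2) \<ge> 1" by linarith
  then have det: "(of_int a * of_int d - of_int b * of_int c :: real)\<^sup>2 \<ge> 1" by simp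
  have "(t - t')\<^sup>2 = (of_int a * of_int d - of_int b * of_int c)\<^sup>2 * (4 * r * r')"
    unfolding tr using ab cd by (intro ford_square_distance) auto
  also have "\<dots> \<ge> 1 * (4 * r * r')"
    using det pos by (intro mult_right_mono) auto
  finally show "ball (t, r) r \<inter> ball (t', r') r' = {}"
    using pos by (intro disjoint_balls_if) auto
qed

lemma child_mem_\<P>_ordered:
  fixes a b c d :: int
  assumes "b > 0" "d > 0" and det: "b * c - a * d = 1"
    and "is_child C (ford_circ (of_int a) (of_int b)) (ford_circ (of_int c) (of_int d))"
  shows "C \<in> \<P>"
proof -
  have "of_int b * of_int c - of_int a * of_int d = (1::real)"
    using det by (metis of_int_1 of_int_diff of_int_mult)
  then have "C = ford_circ (of_int (a + c)) (of_int (b + d))"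
    using child_ford_eq_mediant assms by simp
  moreover have "coprime (a + c) (b + d)"
    using det by (intro coprime_if_det[of _ c _ d]) (simp add: algebra_simps)
  ultimately show ?thesis using ford_circ_mem_\<P>[of "b + d" "a + c"] assms(1,2) by simp
qed

lemma child_mem_\<P>:
  assumes "D \<in> \<P>" "E \<in> \<P>" and child: "is_child C D E"
  shows "C \<in> \<P>"
proof -
  obtain a b :: int where ab: "b > 0" "D = ford_circ (of_int a) (of_int b)"
    using assms(1) by (rule mem_\<P>E)
  obtain c d :: int where cd: "d > 0" "E = ford_circ (of_int c) (of_int d)"
    using assms(2) by (rule mem_\<P>E)
  obtain x r y s where xy: "r > 0" "s > 0" "D = circ x r" "E = circ y s" "x \<noteq> y" "tangent D E"
    using child unfolding is_child_def by fastforce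
  have "x = of_int a / of_int b" "y = of_int c / of_int d"
    using xy ab cd by (auto simp: ford_circ_def circ_eq_iff)
  then have "(of_int a * of_int d - of_int b * of_int c :: real)\<^sup>2 = 1"
    using tangent_ford_iff[of "of_int b" "of_int d" "of_int a" "of_int c"] xy(5,6) ab cd by simp
  then have "real_of_int ((a * d - b * c)\<^sup>2) = of_int 1" by simp
  then have "(a * d - b * c)\<^sup>2 = 1" unfolding of_int_eq_iff .
  then have "a * d - b * c = 1 \<or> a * d - b * c = - 1" by (simp only: power2_eq_1_iff)
  then consider "b * c - a * d = 1" | "d * a - c * b = 1"
    by (metis minus_diff_eq minus_minus mult.commute)
  then show ?thesis
  proof cases
    case 1
    then show ?thesis using child_mem_\<P>_ordered ab cd child by blast
  next
    case 2
    then show ?thesis using child_mem_\<P>_ordered ab cd is_child_commute[OF child] by blast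
  qed
qed

section \<open>Every Ford circle is generated\<close>

abbreviation unit_ford_circles :: "(real \<times> real) set set" where
  "unit_ford_circles \<equiv> {ford_circ (of_int n) 1 | n :: int. True}"

lemma unit_ford_circles_subset_\<P>: "unit_ford_circles \<subseteq> \<P>"
proof
  fix C assume "C \<in> unit_ford_circles"
  then obtain n :: int where "C = ford_circ (of_int n) 1" by blast
  then show "C \<in> \<P>" using ford_circ_mem_\<P>[of 1 n] by simp
qed

lemma reachable_subset_\<P>:
  assumes "(\<lessdot>)\<^sup>*\<^sup>* unit_ford_circles \<A>"
  shows "\<A> \<subseteq> \<P>"
  using assms
proof (induction rule: rtranclp_induct)
  case base
  show ?case by (rule unit_ford_circles_subset_\<P>)
next
  case (step \<A> \<A>')
  from step.hyps(2) obtain C D E where "D \<in> \<A>" "E \<in> \<A>" "is_child C D E" "\<A>' = \<A> \<union> {C}"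
    unfolding adjoins_child_def by (elim exE conjE) (rule that)
  moreover have "\<A> \<subseteq> \<P>" by (rule step.IH)
  ultimately show ?case using child_mem_\<P>[of D E C] by blast
qed

lemma subset_if_reachable: "(\<lessdot>)\<^sup>*\<^sup>* \<A> \<A>' \<Longrightarrow> \<A> \<subseteq> \<A>'"
  by (induction rule: rtranclp_induct) (auto simp: adjoins_child_def)

text \<open>The left parent $p/q$ of $a/b$ comes from the inverse $q$ of $a$ modulo $b$; the right parent
  is the complement.\<close>

lemma mediant_parents:
  fixes a b :: int
  assumes "b > 1" "coprime a b"
  obtains p q r s :: int where
    "0 < q" "q < b" "0 < s" "s < b" "a = p + r" "b = q + s" "q * r - p * s = 1"
proof -
  obtain m n where "m * a + n * b = 1"
    using bezout_int[of a b] unfolding coprime_imp_gcd_eq_1[OF assms(2)] by blast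
  \<comment> \<open>Reducing $m$ modulo $b$ must be compensated in the coefficient of $b$.\<close>
  define q p where "q = m mod b" and "p = - n - a * (m div b)"
  have "m = q + b * (m div b)" by (simp add: q_def)
  then have det: "q * a - p * b = 1"
    using \<open>m * a + n * b = 1\<close> unfolding p_def by algebra
  have "q \<noteq> 0"
  proof
    assume "q = 0"
    then have "1 = b * (- p)" using det by (simp add: mult.commute)
    then have "b dvd 1" by (rule dvdI)
    then show False using assms(1) by simp
  qed
  moreover have "0 \<le> q" "q < b" using assms(1) by (simp_all add: q_def)
  moreover have "q * (a - p) - p * (b - q) = 1" using det by (simp add: algebra_simps)
  ultimately show ?thesis by (intro that[of q "b - q" p "a - p"]) auto
qed

text \<open>Starting from an arbitrary reachable set, rather than from the initial one, lets
  the two induction hypotheses be used one after the other, so that a single set contains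
  both parents.\<close>

lemma ford_circ_reachable:
  fixes a b :: int
  assumes "b > 0" "coprime a b" "(\<lessdot>)\<^sup>*\<^sup>* unit_ford_circles \<A>"
  shows "\<exists>\<A>'. (\<lessdot>)\<^sup>*\<^sup>* \<A> \<A>' \<and> ford_circ (of_int a) (of_int b) \<in> \<A>'"
  using assms
proof (induction "nat b" arbitrary: a b \<A> rule: less_induct)
  case less
  show ?case
  proof (cases "b = 1")
    case True
    then have "ford_circ (of_int a) (of_int b) \<in> unit_ford_circles" by auto
    then show ?thesis using subset_if_reachable[OF less.prems(3)] by blast
  next
    case False
    then have "b > 1" using less.prems by simp
    then obtain p q r s where *: "0 < q" "q < b" "0 < s" "s < b" "a = p + r" "b = q + s"
      and det: "q * r - p * s = 1"
      using less.prems(2) by (rule mediant_parents)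
    let ?D = "ford_circ (of_int p) (of_int q)" and ?E = "ford_circ (of_int r) (of_int s)"
    let ?C = "ford_circ (of_int a) (of_int b)"
    have "coprime p q" using det by (rule coprime_if_det)
    then obtain \<A>1 where A1: "(\<lessdot>)\<^sup>*\<^sup>* \<A> \<A>1" "?D \<in> \<A>1"
      using less.hyps[of q p \<A>] less.prems * by auto
    have "coprime r s"
      using det by (intro coprime_if_det[of s "- p" r "- q"]) (simp add: algebra_simps)
    moreover have reach1: "(\<lessdot>)\<^sup>*\<^sup>* unit_ford_circles \<A>1"
      using less.prems(3) A1(1) by (rule rtranclp_trans)
    ultimately obtain \<A>2 where A2: "(\<lessdot>)\<^sup>*\<^sup>* \<A>1 \<A>2" "?E \<in> \<A>2"
      using less.hyps[of s r \<A>1] * by auto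
    have D: "?D \<in> \<A>2" using A1(2) subset_if_reachable[OF A2(1)] by blast
    have "(\<lessdot>)\<^sup>*\<^sup>* unit_ford_circles \<A>2"
      using reach1 A2(1) by (rule rtranclp_trans)
    then have sub: "\<A>2 \<union> {?C} \<subseteq> \<P>"
      using reachable_subset_\<P> less.prems(1,2) by (simp add: ford_circ_mem_\<P>)
    have det': "of_int q * of_int r - of_int p * of_int s = (1::real)"
      using det by (metis of_int_1 of_int_diff of_int_mult)
    have "is_child ?C ?D ?E"
      using mediant_is_child[OF _ _ det'] * by simp
    moreover have "tangent ?D ?E"
      using tangent_ford_if_det[OF _ _ det'] * by simp
    moreover have "normal_set \<A>2" "normal_set (\<A>2 \<union> {?C})"
      using sub by (auto intro: normal_set_subset[OF normal_set_\<P>])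
    ultimately have "\<A>2 \<lessdot> \<A>2 \<union> {?C}"
      using D A2(2) unfolding adjoins_child_def by blast
    then have "(\<lessdot>)\<^sup>*\<^sup>* \<A> (\<A>2 \<union> {?C})"
      using A1(1) A2(1) by (meson rtranclp.rtrancl_into_rtrancl rtranclp_trans)
    then show ?thesis by blast
  qed
qed

lemma \<P>_eq_\<G>: "\<P> = \<G>"
proof
  show "\<P> \<subseteq> \<G>"
  proof
    fix C assume "C \<in> \<P>"
    then obtain a b :: int where ab: "b > 0" "coprime a b" "C = ford_circ (of_int a) (of_int b)"
      by (rule mem_\<P>E)
    then obtain \<A> where A: "(\<lessdot>)\<^sup>*\<^sup>* unit_ford_circles \<A>" "C \<in> \<A>"
      using ford_circ_reachable[of b a unit_ford_circles] by auto
    moreover have "normal_set \<A>"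
      using normal_set_\<P> reachable_subset_\<P>[OF A(1)] by (rule normal_set_subset)
    ultimately show "C \<in> \<G>" unfolding \<G>_def generated_def by blast
  qed
  show "\<G> \<subseteq> \<P>"
    unfolding \<G>_def generated_def using reachable_subset_\<P> by blast
qed

section \<open>Primitive triples\<close>

text \<open>Expanding the square leaves $st+tu+us=0$; adding $t^2$ on both sides makes the left side factor.\<close>

lemma square_sum_iff_factorization:
  fixes s t u :: int
  shows "(s + t + u)\<^sup>2 = s\<^sup>2 + t\<^sup>2 + u\<^sup>2 \<longleftrightarrow> (s + t) * (t + u) = t\<^sup>2"
  by (auto simp: power2_eq_square algebra_simps)

text \<open>A common divisor $k$ of the two factors satisfies $k^2 \mid t^2$, so it divides $t$, and then
  $s$ and $u$.\<close>

lemma coprime_iff_primitive: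
  fixes s t u :: int
  assumes "(s + t) * (t + u) = t\<^sup>2" "s + t \<noteq> 0"
  shows "coprime (s + t) (t + u) \<longleftrightarrow> gcd s (gcd t u) = 1"
proof
  assume cop: "coprime (s + t) (t + u)"
  have "gcd s (gcd t u) dvd s + t" "gcd s (gcd t u) dvd t + u"
    by (meson dvd_add gcd_dvd1 gcd_dvd2 dvd_trans)+
  then have "is_unit (gcd s (gcd t u))" using cop by (rule coprime_common_divisor[rotated])
  then show "gcd s (gcd t u) = 1" by simp
next
  assume prim: "gcd s (gcd t u) = 1"
  show "coprime (s + t) (t + u)"
  proof (rule coprimeI)
    fix k assume k: "k dvd s + t" "k dvd t + u"
    then have "k\<^sup>2 dvd t\<^sup>2"
      unfolding assms(1)[symmetric] by (simp add: power2_eq_square mult_dvd_mono)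
    then have t: "k dvd t" by simp
    then have "k dvd s" "k dvd u"
      using k by (simp_all add: dvd_add_left_iff dvd_add_right_iff)
    then have "k dvd gcd s (gcd t u)" using t by simp
    then show "is_unit k" using prim by simp
  qed
qed

text \<open>The square root of $m$ is $\gcd(m,t)$: its square is $\gcd(m^2,mn)=m\gcd(m,n)=m$.\<close>

lemma coprime_mult_eq_squareE:
  fixes m n t :: int
  assumes "coprime m n" "m > 0" "m * n = t\<^sup>2"
  obtains a b where "b > 0" "coprime a b" "m = b\<^sup>2" "t = a * b"
proof -
  define b where "b = gcd m t"
  have "b\<^sup>2 = gcd (m\<^sup>2) (t\<^sup>2)" by (simp add: b_def)
  also have "\<dots> = gcd (m * m) (m * n)" by (simp add: assms(3) power2_eq_square)
  also have "\<dots> = \<bar>m\<bar> * gcd m n" by (simp add: gcd_mult_distrib_int)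
  also have "\<dots> = m" using assms(1,2) by simp
  finally have b: "b > 0" "m = b\<^sup>2"
    using assms(2) by (simp_all add: b_def)
  have "b dvd t" by (simp add: b_def)
  then obtain a where a: "t = a * b" by (metis dvdE mult.commute)
  then have "n = a\<^sup>2" using assms(3) b by (simp add: power_mult_distrib)
  then have "coprime a b" using assms(1) b by (simp add: coprime_commute)
  then show ?thesis using that a b by blast
qed

lemma angle_circ_eq_ford_circ:
  fixes s t a b :: int
  assumes "b > 0" "s + t = b\<^sup>2" "t = a * b"
  shows "angle_circ (of_int s) (of_int t) = ford_circ (of_int a) (of_int b)"
proof -
  have "real_of_int s + of_int t = (of_int b)\<^sup>2"
    using assms(2) by (metis of_int_add of_int_power)
  then show ?thesis
    using assms(1,3) by (simp add: angle_circ_def ford_circ_def power2_eq_square)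
qed

text \<open>The triple of the reduced fraction $a/b$ is $(b(b-a),\,ab,\,a(a-b))$.\<close>

lemma angle_triple_iff_ford:
  "(\<exists>s t u :: int. C = angle_circ (of_int s) (of_int t) \<and>
      gcd s (gcd t u) = 1 \<and> s + t > 0 \<and> (s + t + u)\<^sup>2 = s\<^sup>2 + t\<^sup>2 + u\<^sup>2) \<longleftrightarrow>
   (\<exists>a b :: int. C = ford_circ (of_int a) (of_int b) \<and> b > 0 \<and> gcd a b = 1)"
    (is "?angle \<longleftrightarrow> ?ford")
proof
  assume ?angle
  then obtain s t u :: int where C: "C = angle_circ (of_int s) (of_int t)"
    and prim: "gcd s (gcd t u) = 1" "s + t > 0" and fact: "(s + t) * (t + u) = t\<^sup>2"
    unfolding square_sum_iff_factorization by (elim exE conjE) (rule that)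
  have "coprime (s + t) (t + u)"
    using coprime_iff_primitive[OF fact] prim by simp
  then obtain a b where ab: "b > 0" "coprime a b" "s + t = b\<^sup>2" "t = a * b"
    using prim(2) fact by (rule coprime_mult_eq_squareE)
  have "C = ford_circ (of_int a) (of_int b)"
    unfolding C using ab(1,3,4) by (rule angle_circ_eq_ford_circ)
  moreover have "gcd a b = 1" using ab(2) by (simp only: coprime_iff_gcd_eq_1)
  ultimately show ?ford using ab(1) by (intro exI[of _ a] exI[of _ b] conjI)
next
  assume ?ford
  then obtain a b :: int where C: "C = ford_circ (of_int a) (of_int b)"
    and b: "b > 0" and gcd: "gcd a b = 1"
    by (elim exE conjE) (rule that)
  have ab: "b > 0" "coprime a b" using b gcd by (simp_all only: coprime_iff_gcd_eq_1)
  define s t u where "s = b * (b - a)" and "t = a * b" and "u = a * (a - b)"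
  have st: "s + t = b\<^sup>2" "t + u = a\<^sup>2"
    by (simp_all add: s_def t_def u_def power2_eq_square algebra_simps)
  then have fact: "(s + t) * (t + u) = t\<^sup>2" by (simp add: t_def power_mult_distrib)
  have "coprime (s + t) (t + u)" using ab by (simp add: st coprime_commute)
  then have "gcd s (gcd t u) = 1"
    using coprime_iff_primitive[OF fact] ab st by simp
  moreover have "C = angle_circ (of_int s) (of_int t)"
    using angle_circ_eq_ford_circ[OF ab(1) st(1) t_def] C by simp
  moreover have "s + t > 0" using st ab by simp
  moreover have "(s + t + u)\<^sup>2 = s\<^sup>2 + t\<^sup>2 + u\<^sup>2"
    using fact by (simp only: square_sum_iff_factorization)
  ultimately show ?angle by (intro exI[of _ s] exI[of _ t] exI[of _ u] conjI)
qed

theorem theorem2p4: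
  "\<B> = \<P> \<and> \<P> = \<G>"
proof
  show "\<B> = \<P>"
  proof (rule set_eqI)
    fix C
    have "C \<in> \<B> \<longleftrightarrow> (\<exists>s t u :: int. C = angle_circ (of_int s) (of_int t) \<and>
        gcd s (gcd t u) = 1 \<and> s + t > 0 \<and> (s + t + u)\<^sup>2 = s\<^sup>2 + t\<^sup>2 + u\<^sup>2)"
      unfolding \<B>_def by simp
    also have "\<dots> \<longleftrightarrow> C \<in> \<P>"
      unfolding angle_triple_iff_ford \<P>_def by simp
    finally show "C \<in> \<B> \<longleftrightarrow> C \<in> \<P>" .
  qed
  show "\<P> = \<G>" by (rule \<P>_eq_\<G>)
qed

end
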